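(* Let $(m_i)_{i\ge1}$ be an infinite sequence of pairwise relatively prime natural numbers, and put $B_0=1$, $B_j=\prod_{i=1}^j m_i$. For each $i$ let $\pi_i:\{0,\dots,m_i-1\}\to\{0,\dots,m_i-1\}$ be a cyclic permutation of length $m_i$. Let $\alpha\in[0,1)$ have the Cantor series expansion $\alpha=\sum_{j=1}^\infty \frac{c_j}{B_j}$ with $c_j\in\{0,\dots,m_j-1\}$ and $c_j<m_j-1$ for infinitely many $j$. For $n\in\mathbb N$ put $$v(n)=T_{\boldsymbol\pi}^n(\alpha)=\sum_{j=1}^\infty \frac{\pi_j^n(c_j)}{B_j},$$ where $\pi_j^n$ is the $n$-fold composition of $\pi_j$. Then the sequence $(v(n))_{n\ge1}$ is Buck uniformly distributed modulo $1$.
   Context: Every $\alpha\in[0,1)$ has a unique expansion $\alpha=\sum_{j\ge1} c_j/B_j$ with digits $c_j\in\{0,\dots,m_j-1\}$ subject to $c_j<m_j-1$ for infinitely many $j$. The mapping $T_{\boldsymbol\pi}$ associated with $\boldsymbol\pi=(\pi_1,\pi_2,\dots)$ is $T_{\boldsymbol\pi}(\alpha)=\sum_{j\ge1}\pi_j(c_j)/B_j$; its iterates act digitwise, $T_{\boldsymbol\pi}^n(\alpha)=\sum_j \pi_j^n(c_j)/B_j$. For $r\in\mathbb Z$, $m\in\mathbb N$ let $r+(m)=\{n\in\mathbb N: n\equiv r \pmod m\}$. For $S\subset\mathbb N$, Buck's measure density is $\mu^*(S)=\inf\{\sum_{j=1}^k 1/D_j : S\subset\bigcup_{j=1}^k (r_j+(D_j))\}$.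 A set $S$ is Buck measurable if $\mu^*(S)+\mu^*(\mathbb N\setminus S)=1$, and then $\mu(S)=\mu^*(S)$. A sequence $(v(n))$ in $[0,1]$ is Buck uniformly distributed modulo 1 if for every subinterval $I\subset[0,1]$ the set $v^{-1}(I)=\{n\in\mathbb N: v(n)\in I\}$ is Buck measurable and $\mu(v^{-1}(I))=|I|$ (the length of $I$). *)

theory Defs
  imports "HOL-Analysis.Analysis" "HOL-Combinatorics.Orbits" "HOL-Number_Theory.Cong"
begin

text \<open>The positive integers are the subset \<open>{1..}\<close> of \<^typ>\<open>nat\<close>. Sequences indexed by the positive
  integers are functions on \<^typ>\<open>nat\<close> whose value at \<open>0\<close> is never used.\<close>

definition arith_prog :: "int \<Rightarrow> nat \<Rightarrow> nat set" where
  "arith_prog r D = {n \<in> {1..}. [int n = r] (mod int D)}"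

text \<open>Only meant for \<open>S \<subseteq> {1..}\<close>, in which case the infimum is over a nonempty set of
  nonnegative reals.\<close>

definition buck_outer :: "nat set \<Rightarrow> real" where
  "buck_outer S = Inf {(\<Sum>j=1..k. 1 / real (D j)) | (k::nat) r D.
     (\<forall>j\<in>{1..k}. D j > 0) \<and> S \<subseteq> (\<Union>j\<in>{1..k}. arith_prog (r j) (D j))}"

definition buck_measurable :: "nat set \<Rightarrow> bool" where
  "buck_measurable S \<longleftrightarrow> S \<subseteq> {1..} \<and> buck_outer S + buck_outer ({1..} - S) = 1"

text \<open>Only meant for Buck measurable sets.\<close>

definition buck_density :: "nat set \<Rightarrow> real" where
  "buck_density S = buck_outer S"

text \<open>The intervals may be open, closed, half-open, degenerate or empty.\<close>

definition buck_uniformly_distributed :: "(nat \<Rightarrow> real) \<Rightarrow> bool" where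
  "buck_uniformly_distributed v \<longleftrightarrow>
     (\<forall>n\<ge>1. v n \<in> {0..1}) \<and>
     (\<forall>I. is_interval I \<and> I \<subseteq> {0..1} \<longrightarrow>
        buck_measurable {n \<in> {1..}. v n \<in> I} \<and>
        buck_density {n \<in> {1..}. v n \<in> I} = measure lborel I)"

definition cantor_base :: "(nat \<Rightarrow> nat) \<Rightarrow> nat \<Rightarrow> nat" where
  "cantor_base m j = (\<Prod>i=1..j. m i)"

text \<open>The strict inequality for infinitely many digits is written without truncated subtraction.
  Series over \<open>j \<ge> 1\<close> are shifted to start at \<open>0\<close>.\<close>

definition cantor_expansion :: "(nat \<Rightarrow> nat) \<Rightarrow> (nat \<Rightarrow> nat) \<Rightarrow> real \<Rightarrow> bool" where
  "cantor_expansion m c \<alpha> \<longleftrightarrow>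
     (\<forall>j\<ge>1. c j < m j) \<and>
     infinite {j \<in> {1..}. c j + 1 < m j} \<and>
     (\<lambda>j. real (c (Suc j)) / real (cantor_base m (Suc j))) sums \<alpha>"

text \<open>A permutation of \<open>{..<l}\<close> consisting of a single cycle of length \<open>l\<close>; values of \<open>p\<close>
  outside \<open>{..<l}\<close> are irrelevant.\<close>

definition full_cycle :: "nat \<Rightarrow> (nat \<Rightarrow> nat) \<Rightarrow> bool" where
  "full_cycle l p \<longleftrightarrow> bij_betw p {..<l} {..<l} \<and> cyclic_on p {..<l}"

end

(* Let B = B_k. The first k digits of v n determine n modulo each m_j (j <= k), because pi_j is a
   full cycle, and hence modulo B by coprimality. So {n. v n \<in> [x, y]} is covered by one residue
   class modulo B for each of the at most (y - x) B + 2 cells [d/B, (d+1)/B] that meet [x, y], and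
   letting k tend to infinity its outer density is at most y - x. Applying this to an interval and
   to the two intervals that make up its complement, equality follows from subadditivity and from
   the fact that {1..} has outer density 1. *)
theory Submission
  imports Defs
begin

section \<open>Monotonicity, subadditivity and normalization of the outer density\<close>

section \<open>Buck's outer density\<close>

lemma buck_outer_bdd_below:
  "bdd_below {(\<Sum>j=1..k. 1 / real (D j)) | (k::nat) r D.
     (\<forall>j\<in>{1..k}. D j > 0) \<and> S \<subseteq> (\<Union>j\<in>{1..k}. arith_prog (r j) (D j))}"
  by (rule bdd_belowI[of _ 0]) (auto intro!: sum_nonneg)

text \<open>Covers may be indexed by any finite set: an enumeration of \<open>J\<close> turns them
  into covers indexed by \<open>{1..k}\<close>. Disjoint sums and sets of cell numbers serve as
  index sets below.\<close>

lemma buck_outer_le: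
  fixes D :: "'i \<Rightarrow> nat"
  assumes "finite J" and pos: "\<And>j. j \<in> J \<Longrightarrow> D j > 0"
    and cover: "S \<subseteq> (\<Union>j\<in>J. arith_prog (r j) (D j))"
  shows "buck_outer S \<le> (\<Sum>j\<in>J. 1 / real (D j))"
proof -
  obtain h where h: "bij_betw h {1..card J} J"
    using ex_bij_betw_nat_finite_1[OF \<open>finite J\<close>] by blast
  have img: "h ` {1..card J} = J"
    using h by (simp add: bij_betw_def)
  have "(\<Sum>j\<in>J. 1 / real (D j)) = (\<Sum>j=1..card J. 1 / real ((D \<circ> h) j))"
    using sum.reindex_bij_betw[OF h, of "\<lambda>j. 1 / real (D j)"] by simp
  moreover have "\<forall>j\<in>{1..card J}. (D \<circ> h) j > 0"
    using pos img by auto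
  moreover have "S \<subseteq> (\<Union>j\<in>{1..card J}. arith_prog ((r \<circ> h) j) ((D \<circ> h) j))"
  proof -
    have "S \<subseteq> (\<Union>j\<in>h ` {1..card J}. arith_prog (r j) (D j))"
      using cover by (simp only: img)
    then show ?thesis
      by simp
  qed
  ultimately show ?thesis
    unfolding buck_outer_def by (intro cInf_lower[OF _ buck_outer_bdd_below]) blast
qed

text \<open>The infimum is over a nonempty set because the single class 0 modulo 1 covers every
  \<open>S\<close> of positive integers; hence some cover costs less than \<open>x\<close>.\<close>

lemma buck_outer_approx:
  assumes "S \<subseteq> {1..}" and "buck_outer S < x"
  obtains k :: nat and r D where "\<And>j. j \<in> {1..k} \<Longrightarrow> D j > 0"
    and "S \<subseteq> (\<Union>j\<in>{1..k}. arith_prog (r j) (D j))" and "(\<Sum>j=1..k. 1 / real (D j)) < x"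
proof -
  let ?X = "{(\<Sum>j=1..k. 1 / real (D j)) | (k::nat) r D.
     (\<forall>j\<in>{1..k}. D j > 0) \<and> S \<subseteq> (\<Union>j\<in>{1..k}. arith_prog (r j) (D j))}"
  have "S \<subseteq> (\<Union>j\<in>{1..1::nat}. arith_prog 0 1)"
    using assms(1) by (auto simp: arith_prog_def)
  then have "(\<Sum>j=1..1::nat. 1 / real 1) \<in> ?X"
    by (intro CollectI exI[of _ 1] exI[of _ "\<lambda>_. 0"] exI[of _ "\<lambda>_. 1"]) auto
  then have "?X \<noteq> {}"
    by blast
  from cInf_lessD[OF this assms(2)[unfolded buck_outer_def]] show ?thesis
    using that by blast
qed

lemma buck_outer_mono:
  assumes "S \<subseteq> T" and "T \<subseteq> {1..}"
  shows "buck_outer S \<le> buck_outer T"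
proof (rule dense_ge)
  fix x assume "buck_outer T < x"
  then obtain k :: nat and r D where "\<And>j. j \<in> {1..k} \<Longrightarrow> D j > 0"
    and "T \<subseteq> (\<Union>j\<in>{1..k}. arith_prog (r j) (D j))" and "(\<Sum>j=1..k. 1 / real (D j)) < x"
    using buck_outer_approx[OF assms(2)] by metis
  then show "buck_outer S \<le> x"
    using buck_outer_le[of "{1..k}" D S r] assms(1) by fastforce
qed

text \<open>Near-optimal covers of \<open>S\<close> and \<open>T\<close>, each within
  \<open>e / 2\<close>, are joined over the disjoint sum of their index sets, so the costs
  add.\<close>

lemma buck_outer_Un_le:
  assumes "S \<subseteq> {1..}" and "T \<subseteq> {1..}"
  shows "buck_outer (S \<union> T) \<le> buck_outer S + buck_outer T"
proof (rule field_le_epsilon)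
  fix e :: real assume "e > 0"
  then have less: "buck_outer S < buck_outer S + e / 2" "buck_outer T < buck_outer T + e / 2"
    by simp_all
  obtain k :: nat and r D where 1: "\<And>j. j \<in> {1..k} \<Longrightarrow> D j > 0"
    "S \<subseteq> (\<Union>j\<in>{1..k}. arith_prog (r j) (D j))" "(\<Sum>j=1..k. 1 / real (D j)) < buck_outer S + e / 2"
    using buck_outer_approx[OF assms(1) less(1)] by metis
  obtain k' :: nat and r' D' where 2: "\<And>j. j \<in> {1..k'} \<Longrightarrow> D' j > 0"
    "T \<subseteq> (\<Union>j\<in>{1..k'}. arith_prog (r' j) (D' j))" "(\<Sum>j=1..k'. 1 / real (D' j)) < buck_outer T + e / 2"
    using buck_outer_approx[OF assms(2) less(2)] by metis
  have "buck_outer (S \<union> T) \<le> (\<Sum>j\<in>{1..k} <+> {1..k'}. 1 / real (case_sum D D' j))"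
  proof (rule buck_outer_le[where r = "case_sum r r'"])
    show "case_sum D D' j > 0" if "j \<in> {1..k} <+> {1..k'}" for j
      using that 1(1) 2(1) by (auto elim!: PlusE)
    show "S \<union> T \<subseteq> (\<Union>j\<in>{1..k} <+> {1..k'}. arith_prog (case_sum r r' j) (case_sum D D' j))"
      using 1(2) 2(2) unfolding Plus_def by fastforce
  qed auto
  also have "\<dots> = (\<Sum>j=1..k. 1 / real (D j)) + (\<Sum>j=1..k'. 1 / real (D' j))"
    by (simp add: sum.Plus)
  finally show "buck_outer (S \<union> T) \<le> buck_outer S + buck_outer T + e"
    using 1(3) 2(3) by simp
qed

text \<open>\<open>{1..N}\<close> splits into \<open>N div D\<close> blocks of \<open>D\<close>
  consecutive integers, each containing at most one member of the progression.\<close>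

lemma card_arith_prog_le:
  assumes "D > 0" and "D dvd N"
  shows "card (arith_prog r D \<inter> {1..N}) \<le> N div D"
proof -
  \<comment> \<open>The map sends \<open>n\<close> to the number of its block; the shift by 1 is
    there because the first block starts at 1.\<close>
  have inj: "inj_on (\<lambda>n. (n - 1) div D) (arith_prog r D \<inter> {1..N})"
  proof (rule inj_onI)
    fix a b assume a: "a \<in> arith_prog r D \<inter> {1..N}" and b: "b \<in> arith_prog r D \<inter> {1..N}"
      and eq: "(a - 1) div D = (b - 1) div D"
    have "[int a = int b] (mod int D)"
      using a b unfolding arith_prog_def by (auto intro: cong_trans cong_sym)
    then have "[(a - 1) + 1 = (b - 1) + 1] (mod D)"
      using a b by (simp add: cong_int_iff)
    then have "(a - 1) mod D = (b - 1) mod D"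
      by (simp only: cong_add_rcancel_nat) (simp add: cong_def)
    with eq have "a - 1 = b - 1"
      by (metis div_mult_mod_eq)
    then show "a = b"
      using a b by auto
  qed
  have "(\<lambda>n. (n - 1) div D) ` (arith_prog r D \<inter> {1..N}) \<subseteq> {..<N div D}"
  proof (clarsimp)
    fix n assume "Suc 0 \<le> n" "n \<le> N"
    then have "n - 1 < N div D * D"
      using assms by simp
    then show "(n - Suc 0) div D < N div D"
      using assms(1) by (simp add: div_less_iff_less_mult)
  qed
  from card_inj_on_le[OF inj this] show ?thesis
    by simp
qed

text \<open>Counting \<open>{1..N}\<close> through a cover, with \<open>N\<close> a common multiple
  of the moduli, shows that the reciprocals of the moduli sum to at least 1.\<close>

lemma buck_outer_all_ge_1: "1 \<le> buck_outer {1..}"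
proof (rule dense_ge)
  fix x assume "buck_outer {1..} < x"
  then obtain k :: nat and r D where pos: "\<And>j. j \<in> {1..k} \<Longrightarrow> D j > 0"
    and cover: "{1..} \<subseteq> (\<Union>j\<in>{1..k}. arith_prog (r j) (D j))"
    and lt: "(\<Sum>j=1..k. 1 / real (D j)) < x"
    using buck_outer_approx[OF subset_refl] by metis
  define N where "N = (\<Prod>j=1..k. D j)"
  have "N > 0"
    unfolding N_def using pos by (intro prod_pos) auto
  have dvd: "D j dvd N" if "j \<in> {1..k}" for j
    unfolding N_def using that by (intro dvd_prodI) auto
  have "N = card {1..N}"
    by simp
  also have "\<dots> \<le> card (\<Union>j\<in>{1..k}. arith_prog (r j) (D j) \<inter> {1..N})"
    using cover by (intro card_mono) auto
  also have "\<dots> \<le> (\<Sum>j=1..k. card (arith_prog (r j) (D j) \<inter> {1..N}))"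
    by (intro card_UN_le) auto
  also have "\<dots> \<le> (\<Sum>j=1..k. N div D j)"
    using pos dvd by (intro sum_mono card_arith_prog_le) auto
  finally have "real N \<le> real (\<Sum>j=1..k. N div D j)"
    by linarith
  also have "\<dots> = (\<Sum>j=1..k. real N * (1 / real (D j)))"
    using dvd by (simp add: real_of_nat_div)
  also have "\<dots> = real N * (\<Sum>j=1..k. 1 / real (D j))"
    by (simp add: sum_distrib_left)
  finally show "1 \<le> x"
    using \<open>N > 0\<close> lt by simp
qed

section \<open>Endpoints and length of intervals, and the number of grid cells they meet\<close>

section \<open>Intervals\<close>

text \<open>Infimum and supremum serve as endpoints. The sandwich treats open, closed and half-open
  intervals alike, since membership of the endpoints affects neither length nor density.\<close>

lemma is_interval_unit_endpoints:
  fixes I :: "real set"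
  assumes "is_interval I" and "I \<subseteq> {0..1}"
  obtains a b where "0 \<le> a" "a \<le> b" "b \<le> 1" "{a<..<b} \<subseteq> I" "I \<subseteq> {a..b}"
proof (cases "I = {}")
  case True
  then show ?thesis
    using that[of 0 0] by auto
next
  case False
  have bdd: "bdd_above I" "bdd_below I"
    using assms(2) by (meson bdd_above_Icc bdd_above_mono bdd_below_Icc bdd_below_mono)+
  have sub: "I \<subseteq> {Inf I..Sup I}"
    using bdd by (auto intro: cInf_lower cSup_upper)
  have "{Inf I<..<Sup I} \<subseteq> I"
  proof
    fix x assume x: "x \<in> {Inf I<..<Sup I}"
    obtain u where "u \<in> I" "u < x"
      using cInf_lessD[OF False] x by auto
    moreover obtain w where "w \<in> I" "x < w"
      using less_cSupD[OF False] x by auto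
    ultimately show "x \<in> I"
      using assms(1) unfolding is_interval_1 by (meson less_imp_le)
  qed
  moreover have "0 \<le> Inf I"
    using False assms(2) by (intro cInf_greatest) auto
  moreover have "Sup I \<le> 1"
    using False assms(2) by (intro cSup_least) auto
  moreover have "Inf I \<le> Sup I"
    using False sub by fastforce
  ultimately show ?thesis
    using that sub by blast
qed

text \<open>\<open>I\<close> is the open interval with at most two points added, hence Borel;
  monotonicity then squeezes its measure.\<close>

lemma measure_lborel_between:
  fixes a b :: real
  assumes "a \<le> b" "{a<..<b} \<subseteq> I" "I \<subseteq> {a..b}"
  shows "measure lborel I = b - a"
proof -
  have I: "I = {a<..<b} \<union> (I \<inter> {a, b})"
    using assms by force
  have "I \<inter> {a, b} \<in> sets borel"
    by (intro borel_closed finite_imp_closed) auto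
  from sets.Un[OF greaterThanLessThan_borel[of a b] this] have meas: "I \<in> sets borel"
    by (simp only: I[symmetric])
  have Icc: "{a..b} \<in> fmeasurable lborel"
    by (rule fmeasurableI) (auto simp: emeasure_lborel_Icc_eq)
  then have "I \<in> fmeasurable lborel"
    by (rule fmeasurableI2) (use assms(3) meas in simp_all)
  then have "measure lborel {a<..<b} \<le> measure lborel I"
    using assms(2) by (simp add: measure_mono_fmeasurable)
  moreover have "measure lborel I \<le> measure lborel {a..b}"
    by (rule measure_mono_fmeasurable) (use meas assms(3) Icc in simp_all)
  ultimately show ?thesis
    using assms(1) by simp
qed

text \<open>The number \<open>d\<close> of a cell meeting \<open>[x, y]\<close> is an integer
  between \<open>x * B - 1\<close> and \<open>y * B\<close>.\<close>

lemma card_cells_meeting_interval_le: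
  fixes x y :: real and B :: nat
  assumes "x \<le> y" and "B > 0"
  defines "G \<equiv> {d::nat. real d / B \<le> y \<and> x \<le> (real d + 1) / B}"
  shows "finite G" and "real (card G) \<le> (y - x) * B + 2"
proof -
  let ?J = "{\<lceil>x * B - 1\<rceil>..\<lfloor>y * B\<rfloor>}"
  have sub: "int ` G \<subseteq> ?J"
  proof
    fix i assume "i \<in> int ` G"
    then obtain d where d: "i = int d" "real d / B \<le> y" "x \<le> (real d + 1) / B"
      by (auto simp: G_def)
    then show "i \<in> ?J"
      using \<open>B > 0\<close> by (auto simp: field_simps le_floor_iff ceiling_le_iff)
  qed
  then have "finite (int ` G)"
    by (rule finite_subset) simp
  then show "finite G"
    by (simp add: finite_image_iff)
  have "card G = card (int ` G)"
    by (simp add: card_image)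
  also have "\<dots> \<le> card ?J"
    using sub by (intro card_mono) auto
  finally have le: "real (card G) \<le> real (nat (\<lfloor>y * B\<rfloor> - \<lceil>x * B - 1\<rceil> + 1))"
    by simp
  have "x * B \<le> y * B"
    using assms(1) by (simp add: mult_right_mono)
  \<comment> \<open>This makes the argument of \<open>nat\<close> nonnegative, so the conversion
    does not truncate.\<close>
  then have "\<lceil>x * B - 1\<rceil> \<le> \<lfloor>y * B\<rfloor> + 1"
    by linarith
  then have "real (nat (\<lfloor>y * B\<rfloor> - \<lceil>x * B - 1\<rceil> + 1)) =
      of_int \<lfloor>y * B\<rfloor> - of_int \<lceil>x * B - 1\<rceil> + 1"
    by simp
  also have "\<dots> \<le> y * B - (x * B - 1) + 1"
    by linarith
  finally show "real (card G) \<le> (y - x) * B + 2"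
    using le by (simp add: algebra_simps)
qed

section \<open>Partial sums, digits and cells of Cantor series\<close>

section \<open>Cantor series\<close>

lemma cantor_base_Suc: "cantor_base m (Suc k) = cantor_base m k * m (Suc k)"
  by (simp add: cantor_base_def)

lemma cantor_base_pos: "(\<And>i. i \<ge> 1 \<Longrightarrow> m i > 0) \<Longrightarrow> cantor_base m k > 0"
  unfolding cantor_base_def by (intro prod_pos) auto

text \<open>Horner's scheme for the integer with mixed radix digits \<open>c 1\<close>, ...,
  \<open>c k\<close>, most significant first. Over \<open>cantor_base m k\<close> it is the
  \<open>k\<close>-th partial sum, so it numbers a cell.\<close>

fun cantor_numerator :: "(nat \<Rightarrow> nat) \<Rightarrow> (nat \<Rightarrow> nat) \<Rightarrow> nat \<Rightarrow> nat" where
  "cantor_numerator m c 0 = 0"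
| "cantor_numerator m c (Suc k) = cantor_numerator m c k * m (Suc k) + c (Suc k)"

lemma cantor_numerator_eq_sum:
  assumes "\<And>i. i \<ge> 1 \<Longrightarrow> m i > 0"
  shows "real (cantor_numerator m c k) / cantor_base m k =
    (\<Sum>j<k. real (c (Suc j)) / cantor_base m (Suc j))"
proof (induction k)
  case (Suc k)
  have "m (Suc k) > 0"
    using assms by simp
  then have "real (cantor_numerator m c (Suc k)) / cantor_base m (Suc k) =
      real (cantor_numerator m c k) / cantor_base m k + real (c (Suc k)) / cantor_base m (Suc k)"
    by (simp add: cantor_base_Suc add_divide_distrib)
  then show ?case
    by (simp add: Suc.IH)
qed simp

text \<open>Reduction modulo the last radix recovers the last digit; cancelling it leaves the
  shorter numerators, to which induction applies.\<close>

lemma cantor_numerator_digits_eq: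
  assumes "\<And>j. j \<ge> 1 \<Longrightarrow> c j < m j" and "\<And>j. j \<ge> 1 \<Longrightarrow> c' j < m j"
    and "cantor_numerator m c k = cantor_numerator m c' k"
  shows "j \<in> {1..k} \<Longrightarrow> c j = c' j"
  using assms(3)
proof (induction k)
  case (Suc k)
  have lt: "c (Suc k) < m (Suc k)" "c' (Suc k) < m (Suc k)"
    using assms(1,2) by auto
  have eq: "cantor_numerator m c k * m (Suc k) + c (Suc k) =
      cantor_numerator m c' k * m (Suc k) + c' (Suc k)"
    using Suc.prems by simp
  have "(cantor_numerator m c k * m (Suc k) + c (Suc k)) mod m (Suc k) =
      (cantor_numerator m c' k * m (Suc k) + c' (Suc k)) mod m (Suc k)"
    by (simp only: eq)
  then have last: "c (Suc k) = c' (Suc k)"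
    using lt by simp
  then have "cantor_numerator m c k = cantor_numerator m c' k"
    using eq lt by simp
  then show ?case
    using Suc last by (cases "j = Suc k") auto
qed simp

text \<open>The sum lies in the closed cell numbered by the first \<open>k\<close> digits. The upper
  end is included because all later digits may be maximal, which permuting the digits can bring
  about.\<close>

lemma cantor_series_bounds:
  assumes m: "\<And>i. i \<ge> 1 \<Longrightarrow> m i > 0" and c: "\<And>j. j \<ge> 1 \<Longrightarrow> c j < m j"
  defines "s \<equiv> (\<Sum>j. real (c (Suc j)) / cantor_base m (Suc j))"
  shows "real (cantor_numerator m c k) / cantor_base m k \<le> s"
    and "s \<le> (real (cantor_numerator m c k) + 1) / cantor_base m k"
proof -
  let ?f = "\<lambda>j. real (c (Suc j)) / cantor_base m (Suc j)"
  have numerator: "real (cantor_numerator m c k) / cantor_base m k = sum ?f {..<k}"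
    using m by (rule cantor_numerator_eq_sum)
  have nonneg: "?f j \<ge> 0" for j
    by simp
  \<comment> \<open>Adding the remainder \<open>1 / cantor_base\<close> to the partial sum gives a
    nonincreasing sequence, because a digit plus 1 is at most its radix.\<close>
  have telescope: "sum ?f {..<k + l} + 1 / cantor_base m (k + l) \<le> sum ?f {..<k} + 1 / cantor_base m k" for k l
  proof (induction l)
    case (Suc l)
    have "real (c (Suc (k + l))) + 1 \<le> m (Suc (k + l))"
      using c[of "Suc (k + l)"] by linarith
    then have "?f (k + l) + 1 / cantor_base m (Suc (k + l)) \<le> m (Suc (k + l)) / cantor_base m (Suc (k + l))"
      by (simp add: add_divide_distrib[symmetric] divide_right_mono)
    also have "\<dots> = 1 / cantor_base m (k + l)"
      using m[of "Suc (k + l)"] by (simp add: cantor_base_Suc)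
    finally show ?case
      using Suc by simp
  qed simp
  have le: "sum ?f {..<n} \<le> sum ?f {..<k} + 1 / cantor_base m k" for n k
  proof -
    \<comment> \<open>Passing to \<open>k + n\<close> terms also handles
      \<open>n < k\<close>.\<close>
    have "sum ?f {..<n} \<le> sum ?f {..<k + n}"
      by (intro sum_mono2) auto
    moreover have "0 \<le> 1 / real (cantor_base m (k + n))"
      by simp
    ultimately show ?thesis
      using telescope[of k n] by linarith
  qed
  have summable: "summable ?f"
    by (rule summableI_nonneg_bounded[OF nonneg, of _ "sum ?f {..<0} + 1 / cantor_base m 0"]) (rule le)
  show "real (cantor_numerator m c k) / cantor_base m k \<le> s"
    unfolding s_def numerator using summable
    by (intro sum_le_suminf) auto
  have "s \<le> sum ?f {..<k} + 1 / cantor_base m k"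
    unfolding s_def using summable le by (intro suminf_le_const) auto
  then show "s \<le> (real (cantor_numerator m c k) + 1) / cantor_base m k"
    by (simp add: add_divide_distrib numerator)
qed

text \<open>Factors equal to 1 leave the base unchanged, while each factor of at least 2 at least
  doubles it; infinitely many of the latter occur.\<close>

lemma cantor_base_unbounded:
  assumes m: "\<And>i. i \<ge> 1 \<Longrightarrow> m i > 0" and inf: "infinite {j \<in> {1..}. 2 \<le> m j}"
  shows "\<exists>k. cantor_base m k \<ge> K"
proof (induction K)
  case (Suc K)
  then obtain k where k: "cantor_base m k \<ge> K"
    by blast
  obtain j where j: "j > k" "2 \<le> m j"
    using inf unfolding infinite_nat_iff_unbounded by blast
  have mono: "cantor_base m a \<le> cantor_base m b" if "a \<le> b" for a b
    using that
  proof (induction b rule: dec_induct)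
    case (step n)
    have "cantor_base m n * 1 \<le> cantor_base m n * m (Suc n)"
      using m[of "Suc n"] by (intro mult_le_mono2) auto
    then show ?case
      using step.IH unfolding cantor_base_Suc by linarith
  qed simp
  have "cantor_base m j = cantor_base m (j - 1) * m j"
    using j(1) cantor_base_Suc[of m "j - 1"] by simp
  moreover have "cantor_base m k \<le> cantor_base m (j - 1)"
    using j(1) by (intro mono) auto
  moreover have "cantor_base m (j - 1) * 2 \<le> cantor_base m (j - 1) * m j"
    using j(2) by (rule mult_le_mono2)
  moreover have "cantor_base m (j - 1) > 0"
    using m by (rule cantor_base_pos)
  ultimately have "Suc K \<le> cantor_base m j"
    using k by linarith
  then show ?case
    by blast
qed simp

section \<open>Iterates of full cycles, preimages of closed intervals, and uniform
  distribution\<close>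

section \<open>Full cycles and uniform distribution\<close>

lemma full_cycle_funpow_less:
  assumes "full_cycle l p" and "x < l"
  shows "(p ^^ n) x < l"
  using cyclic_on_funpow_in[of p "{..<l}" x n] assms by (simp add: full_cycle_def)

text \<open>The first return time to \<open>x\<close> is the size of its orbit, hence
  \<open>l\<close>; before that time the iterates are distinct, so equal iterates have exponents
  that agree modulo \<open>l\<close>.\<close>

lemma full_cycle_funpow_eq_imp_cong:
  assumes "full_cycle l p" and "x < l" and eq: "(p ^^ i) x = (p ^^ j) x"
  shows "[i = j] (mod l)"
proof -
  have orb: "orbit p x = {..<l}"
    using assms(1,2) by (auto simp: full_cycle_def cyclic_on_alldef)
  then have x: "x \<in> orbit p x"
    using assms(2) by simp
  define t where "t = funpow_dist1 p x x"
  have "t > 0" and t: "(p ^^ t) x = x"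
    using funpow_dist1_prop[OF x] by (auto simp: t_def)
  have inj: "inj_on (\<lambda>n. (p ^^ n) x) {0..<t}"
    unfolding t_def by (rule inj_on_funpow_dist1[OF x])
  have "card (orbit p x) = t"
    using card_image[OF inj] by (simp add: orbit_conv_funpow_dist1[OF x] t_def)
  then have "t = l"
    using orb by simp
  have "(p ^^ (i mod t)) x = (p ^^ (j mod t)) x"
    using eq by (simp add: funpow_mod_eq[OF t])
  then have "i mod t = j mod t"
    using inj \<open>t > 0\<close> by (auto dest: inj_onD)
  then show ?thesis
    by (simp add: cong_def \<open>t = l\<close>)
qed

text \<open>Degenerate intervals are included, since the pieces \<open>[0, a]\<close>,
  \<open>[a, b]\<close> and \<open>[b, 1]\<close> to which this is applied may be single
  points.\<close>

lemma buck_outer_vimage_Icc_le: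
  assumes m: "\<And>i. i \<ge> 1 \<Longrightarrow> m i > 0"
    and cop: "\<And>i j. i \<ge> 1 \<Longrightarrow> j \<ge> 1 \<Longrightarrow> i \<noteq> j \<Longrightarrow> coprime (m i) (m j)"
    and cyc: "\<And>i. i \<ge> 1 \<Longrightarrow> full_cycle (m i) (\<pi> i)"
    and c: "\<And>j. j \<ge> 1 \<Longrightarrow> c j < m j"
    and inf: "infinite {j \<in> {1..}. c j + 1 < m j}"
    and v: "\<And>n. n \<ge> 1 \<Longrightarrow> v n = (\<Sum>j. real ((\<pi> (Suc j) ^^ n) (c (Suc j))) / real (cantor_base m (Suc j)))"
    and xy: "x \<le> y"
  shows "buck_outer {n \<in> {1..}. v n \<in> {x..y}} \<le> y - x"
proof (rule field_le_epsilon)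
  fix e :: real assume "e > 0"
  let ?S = "{n \<in> {1..}. v n \<in> {x..y}}"
  \<comment> \<open>The condition on infinitely many digits enters here: it forces infinitely many
    moduli to be at least 2, so the base is unbounded.\<close>
  have "{j \<in> {1..}. c j + 1 < m j} \<subseteq> {j \<in> {1..}. 2 \<le> m j}"
    by auto
  then have "infinite {j \<in> {1..}. 2 \<le> m j}"
    using inf by (rule infinite_super)
  \<comment> \<open>The base is taken so large that the 2 extra cells in the count cost at most
    \<open>e\<close> in total.\<close>
  from cantor_base_unbounded[OF m this] obtain k where "nat \<lceil>2 / e\<rceil> \<le> cantor_base m k"
    by blast
  then have k: "2 / e \<le> cantor_base m k"
    by linarith
  define B where "B = cantor_base m k"
  have "B > 0"
    unfolding B_def using m by (rule cantor_base_pos)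
  define dig where "dig n j = (\<pi> j ^^ n) (c j)" for n j
  define F where "F n = cantor_numerator m (dig n) k" for n
  have dig: "dig n j < m j" if "j \<ge> 1" for n j
    unfolding dig_def using cyc c that by (intro full_cycle_funpow_less) auto
  have cell: "real (F n) / B \<le> v n" "v n \<le> (real (F n) + 1) / B" if "n \<ge> 1" for n
    using cantor_series_bounds[where c = "dig n" and k = k, OF m dig] that unfolding F_def B_def v[OF that] dig_def by auto
  \<comment> \<open>Equal cell numbers give equal digits, hence congruence modulo each
    \<open>m i\<close> with \<open>i\<close> in \<open>{1..k}\<close>; coprimality combines
    these.\<close>
  have cong: "[n = n'] (mod B)" if "F n = F n'" for n n'
    unfolding B_def cantor_base_def
  proof (rule coprime_cong_prod_nat)
    fix i assume i: "i \<in> {1..k}"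
    have "dig n i = dig n' i"
      using dig dig that i unfolding F_def by (rule cantor_numerator_digits_eq)
    then show "[n = n'] (mod m i)"
      unfolding dig_def using i by (intro full_cycle_funpow_eq_imp_cong[OF cyc c]) auto
  qed (use cop in auto)
  define G where "G = {d::nat. real d / B \<le> y \<and> x \<le> (real d + 1) / B}"
  have G: "finite G" "real (card G) \<le> (y - x) * B + 2"
    unfolding G_def using card_cells_meeting_interval_le[OF xy \<open>B > 0\<close>] by auto
  \<comment> \<open>Any \<open>n\<close> in cell \<open>d\<close> represents its residue class. For
    a cell that is never visited the choice is arbitrary, which can only enlarge the cover.\<close>
  define r where "r d = int (SOME n. F n = d)" for d
  have "?S \<subseteq> (\<Union>d\<in>G. arith_prog (r d) B)"
  proof
    fix n assume n: "n \<in> ?S"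
    then have "F n \<in> G"
      using cell[of n] by (auto simp: G_def)
    moreover have "F (SOME n'. F n' = F n) = F n"
      by (rule someI) simp
    then have "n \<in> arith_prog (r (F n)) B"
      using n cong[of n "SOME n'. F n' = F n"] by (auto simp: arith_prog_def r_def cong_int_iff)
    ultimately show "n \<in> (\<Union>d\<in>G. arith_prog (r d) B)"
      by blast
  qed
  then have "buck_outer ?S \<le> (\<Sum>d\<in>G. 1 / real B)"
    using G(1) \<open>B > 0\<close> by (intro buck_outer_le) auto
  also have "\<dots> = card G / B"
    by simp
  also have "\<dots> \<le> ((y - x) * B + 2) / B"
    using G(2) by (intro divide_right_mono) auto
  also have "\<dots> = y - x + 2 / B"
    using \<open>B > 0\<close> by (simp add: add_divide_distrib)
  also have "\<dots> \<le> y - x + e"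
    using k \<open>e > 0\<close> \<open>B > 0\<close> by (simp add: B_def field_simps)
  finally show "buck_outer ?S \<le> y - x + e" .
qed

theorem theorem1:
  fixes m c :: "nat \<Rightarrow> nat"
    and \<pi> :: "nat \<Rightarrow> nat \<Rightarrow> nat"
    and \<alpha> :: real
    and v :: "nat \<Rightarrow> real"
  assumes "\<forall>i\<ge>1. m i > 0"
    and "\<forall>i\<ge>1. \<forall>j\<ge>1. i \<noteq> j \<longrightarrow> coprime (m i) (m j)"
    and "\<forall>i\<ge>1. full_cycle (m i) (\<pi> i)"
    and "0 \<le> \<alpha>" and "\<alpha> < 1"
    and "cantor_expansion m c \<alpha>"
    and "\<forall>n\<ge>1. v n = (\<Sum>j. real ((\<pi> (Suc j) ^^ n) (c (Suc j))) / real (cantor_base m (Suc j)))"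
  shows "buck_uniformly_distributed v"
proof -
  have m: "\<And>i. i \<ge> 1 \<Longrightarrow> m i > 0" and c: "\<And>j. j \<ge> 1 \<Longrightarrow> c j < m j"
    and inf: "infinite {j \<in> {1..}. c j + 1 < m j}"
    and cyc: "\<And>i. i \<ge> 1 \<Longrightarrow> full_cycle (m i) (\<pi> i)"
    using assms(1,3,6) by (auto simp: cantor_expansion_def)
  have le: "buck_outer {n \<in> {1..}. v n \<in> {x..y}} \<le> y - x" if "x \<le> y" for x y
    using buck_outer_vimage_Icc_le[OF m _ cyc c inf _ that] assms(2,7) by blast
  have unit: "v n \<in> {0..1}" if n: "n \<ge> 1" for n
  proof -
    have digits: "(\<pi> j ^^ n) (c j) < m j" if "j \<ge> 1" for j
      using cyc c that by (intro full_cycle_funpow_less) auto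
    \<comment> \<open>At \<open>k = 0\<close> the numerator is 0 and the base is 1, so the cell is
      the whole unit interval.\<close>
    note bounds = cantor_series_bounds[where m = m and c = "\<lambda>j. (\<pi> j ^^ n) (c j)" and k = 0]
    have "0 \<le> v n" "v n \<le> 1"
      using bounds[OF _ digits] m assms(7) n by (simp_all add: cantor_base_def)
    then show ?thesis
      by simp
  qed
  moreover have "buck_measurable {n \<in> {1..}. v n \<in> I} \<and>
      buck_density {n \<in> {1..}. v n \<in> I} = measure lborel I" if I: "is_interval I" "I \<subseteq> {0..1}" for I
  proof -
    let ?S = "{n \<in> {1..}. v n \<in> I}"
    obtain a b where ab: "0 \<le> a" "a \<le> b" "b \<le> 1" "{a<..<b} \<subseteq> I" "I \<subseteq> {a..b}"
      using is_interval_unit_endpoints[OF I] .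
    have "buck_outer ?S \<le> buck_outer {n \<in> {1..}. v n \<in> {a..b}}"
      using ab(5) by (intro buck_outer_mono) auto
    then have S: "buck_outer ?S \<le> b - a"
      using le[OF ab(2)] by linarith
    \<comment> \<open>Closed pieces may overlap \<open>I\<close> at \<open>a\<close> and
      \<open>b\<close>; this is harmless because the three lengths still add up to 1.\<close>
    have "{1..} - ?S \<subseteq> {n \<in> {1..}. v n \<in> {0..a}} \<union> {n \<in> {1..}. v n \<in> {b..1}}"
    proof
      fix n assume n: "n \<in> {1..} - ?S"
      then have "0 \<le> v n" "v n \<le> 1" "v n \<notin> {a<..<b}"
        using ab(4) unit[of n] by auto
      then show "n \<in> {n \<in> {1..}. v n \<in> {0..a}} \<union> {n \<in> {1..}. v n \<in> {b..1}}"
        using n by auto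
    qed
    then have "buck_outer ({1..} - ?S) \<le>
        buck_outer ({n \<in> {1..}. v n \<in> {0..a}} \<union> {n \<in> {1..}. v n \<in> {b..1}})"
      by (intro buck_outer_mono) auto
    also have "\<dots> \<le> buck_outer {n \<in> {1..}. v n \<in> {0..a}} + buck_outer {n \<in> {1..}. v n \<in> {b..1}}"
      by (intro buck_outer_Un_le) auto
    also have "\<dots> \<le> a + (1 - b)"
      using le[OF ab(1)] le[OF ab(3)] by simp
    finally have co: "buck_outer ({1..} - ?S) \<le> a + (1 - b)" .
    have "?S \<union> ({1..} - ?S) = {1..}"
      by auto
    then have "1 \<le> buck_outer ?S + buck_outer ({1..} - ?S)"
      using buck_outer_all_ge_1 buck_outer_Un_le[of ?S "{1..} - ?S"] by fastforce
    \<comment> \<open>The upper bounds \<open>b - a\<close> and \<open>a + (1 - b)\<close> sum to 1,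
      and so do not exceed the lower bound for the sum; both must be attained.\<close>
    then have "buck_outer ?S = b - a" and "buck_outer ?S + buck_outer ({1..} - ?S) = 1"
      using S co by linarith+
    then show ?thesis
      using measure_lborel_between[OF ab(2,4,5)]
      by (auto simp: buck_measurable_def buck_density_def)
  qed
  ultimately show ?thesis
    unfolding buck_uniformly_distributed_def by blast
qed

end
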